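(* Let $T>0$, let $\gamma,\sigma>0$ and $W\in C^2(\mathbb{T})$. Let $\{(q_i,p_i)\}_{i=1}^N$ be the interacting particle system defined in the context, with initial data as specified there, and let $\rho_\epsilon(x,t):=\frac1N\sum_{i=1}^Nw_\epsilon(x-q_i(t))$. Assume the scaling $N\epsilon^\theta=1$ with $\theta$ large enough. Then, for $x\in\mathbb{T}$ and $t\in[0,T]$, $$\frac1N\sum_{i=1}^N\Big(\frac1N\sum_{j=1}^NW'(q_i(t)-q_j(t))\Big)w_\epsilon(x-q_i(t))=\{W'\ast\rho_\epsilon(\cdot,t)\}(x)\,\rho_\epsilon(x,t)+r_{1,\epsilon}\,\rho_\epsilon(x,t)+r_{2,\epsilon},$$ where $r_{1,\epsilon}$ and $r_{2,\epsilon}$ are stochastic remainders (depending on $x,t,\omega$) such that $$|r_{1,\epsilon}|\le C(W)\sqrt\epsilon\qquad\text{and}\qquad\mathbb{E}[|r_{2,\epsilon}|]\le C(W,f_0)\{\sqrt\epsilon+\epsilon^\beta\}$$ for some $\beta=\beta(\theta)>0$, where the constants do not depend on $\epsilon$, $N$, $x$ or $t\in[0,T]$.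
   Context: $\mathbb{T}=\mathbb{R}/2\pi\mathbb{Z}$; $\ast$ is convolution on $\mathbb{T}$. For $\epsilon>0$, $w_\epsilon(x):=Z_\epsilon^{-1}\exp\{-\sin^2(x/2)/(\epsilon^2/2)\}$, with $Z_\epsilon$ the normalising constant making $\int_{\mathbb{T}}w_\epsilon=1$ (von Mises density). Interacting particles: $(q_i,p_i)\in\mathbb{T}\times\mathbb{R}$, $i=1,\dots,N$, solve $$\dot q_i=p_i,\qquad \dot p_i=-\gamma p_i-\frac1N\sum_{j=1}^NW'(q_i-q_j)+\sigma\dot\beta_i,$$ with $\beta_1,\dots,\beta_N$ independent Brownian motions and i.i.d. initial data $(q_{i,0},p_{i,0})$ (independent of the Brownian motions). Auxiliary (McKean--Vlasov) particles: a process $(\overline q,\overline p)$ solves $\dot{\overline q}=\overline p$, $\dot{\overline p}=-\gamma\overline p-W'\ast\mu_t(\overline q)+\sigma\dot\beta$, where $\mu_t$ is the law of $\overline q(t)$. Initial data: the common law of the initial data $(q_{i,0},p_{i,0})$ is the law of $(\overline q_{\mathrm{aux}}(t_0),\overline p_{\mathrm{aux}}(t_0))$ for some $t_0>0$, where $(\overline q_{\mathrm{aux}},\overline p_{\mathrm{aux}})$ solves the McKean--Vlasov dynamics above starting from a probability density $f_0$ on $\mathbb{T}\times\mathbb{R}$ with $\int_{\mathbb{T}}\int_{\mathbb{R}}f_0(q,p)(1+p^2)^k\,dp\,dq<\infty$ for all $k\in\mathbb{N}$. "$N\epsilon^\theta=1$ with $\theta$ large enough" means: there is $\theta_0$ such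 that the statement holds for every $\theta>\theta_0$, with $\epsilon\in(0,1]$ and $N\in\mathbb{N}$ linked by $N=\epsilon^{-\theta}$. Dependence of constants on the fixed quantities $T,t_0,\gamma,\sigma$ is suppressed in the notation. *)

theory Defs
  imports "HOL-Probability.Probability" "HOL-Library.Real_Mod"
begin

text \<open>
  A point of the torus \<open>\<real>/2\<pi>\<int>\<close> is given by a real representative, and equality of points is
  congruence modulo \<open>2\<pi>\<close>.  Functions on the torus are \<open>2\<pi>\<close>-periodic functions on the reals.
  As a measure space the torus is the fundamental domain \<open>[0, 2\<pi>)\<close> with Lebesgue measure.
\<close>

definition torus :: "real measure" where
  "torus = restrict_space lborel {0..<2 * pi}"

definition torus_fun :: "(real \<Rightarrow> 'a) \<Rightarrow> bool" where
  "torus_fun g \<longleftrightarrow> (\<forall>x. g (x + 2 * pi) = g x)"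

definition torus_C2 :: "(real \<Rightarrow> real) \<Rightarrow> bool" where
  "torus_C2 W \<longleftrightarrow>
     torus_fun W \<and> W C1_differentiable_on UNIV \<and> deriv W C1_differentiable_on UNIV"

definition torus_conv :: "(real \<Rightarrow> real) \<Rightarrow> (real \<Rightarrow> real) \<Rightarrow> real \<Rightarrow> real" where
  "torus_conv g h x = (LINT y|torus. g (x - y) * h y)"

definition torus_conv_measure :: "(real \<Rightarrow> real) \<Rightarrow> real measure \<Rightarrow> real \<Rightarrow> real" where
  "torus_conv_measure g \<mu> x = (LINT y|\<mu>. g (x - y))"

definition von_mises :: "real \<Rightarrow> real \<Rightarrow> real" where
  "von_mises \<epsilon> x =
     exp (- (sin (x / 2))\<^sup>2 / (\<epsilon>\<^sup>2 / 2)) / (LINT y|torus. exp (- (sin (y / 2))\<^sup>2 / (\<epsilon>\<^sup>2 / 2)))"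

text \<open>The state space \<open>\<T> \<times> \<real>\<close>, and the state at time \<open>t\<close> of a process as an element of it.\<close>

definition phase_space :: "(real \<times> real) measure" where
  "phase_space = torus \<Otimes>\<^sub>M lborel"

definition state ::
  "(real \<Rightarrow> 'w \<Rightarrow> real) \<Rightarrow> (real \<Rightarrow> 'w \<Rightarrow> real) \<Rightarrow> real \<Rightarrow> 'w \<Rightarrow> real \<times> real" where
  "state q p t \<omega> = (q t \<omega> rmod (2 * pi), p t \<omega>)"

text \<open>Probability densities on \<open>\<T> \<times> \<real>\<close> with finite moments of all orders in the momentum.\<close>

definition initial_density :: "(real \<times> real \<Rightarrow> real) \<Rightarrow> bool" where
  "initial_density f0 \<longleftrightarrow>
     f0 \<in> borel_measurable phase_space \<and>
     (\<forall>z\<in>space phase_space. f0 z \<ge> 0) \<and>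
     (\<integral>\<^sup>+z. ennreal (f0 z) \<partial>phase_space) = 1 \<and>
     (\<forall>k::nat. (\<integral>\<^sup>+z. ennreal (f0 z * (1 + (snd z)\<^sup>2) ^ k) \<partial>phase_space) < \<infinity>)"

definition brownian_motion :: "'w measure \<Rightarrow> (real \<Rightarrow> 'w \<Rightarrow> real) \<Rightarrow> bool" where
  "brownian_motion M B \<longleftrightarrow>
     prob_space M \<and>
     (\<forall>t\<ge>0. B t \<in> borel_measurable M) \<and>
     (AE \<omega> in M. B 0 \<omega> = 0 \<and> continuous_on {0..} (\<lambda>t. B t \<omega>)) \<and>
     (\<forall>s t. 0 \<le> s \<and> s < t \<longrightarrow>
        distributed M lborel (\<lambda>\<omega>. B t \<omega> - B s \<omega>) (\<lambda>y. ennreal (normal_density 0 (sqrt (t - s)) y))) \<and>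
     (\<forall>(n::nat) \<tau>. 0 \<le> \<tau> 0 \<and> incseq \<tau> \<longrightarrow>
        prob_space.indep_vars M (\<lambda>_. borel) (\<lambda>k \<omega>. B (\<tau> (Suc k)) \<omega> - B (\<tau> k) \<omega>) {..<n})"

text \<open>
  Independence of two random variables: \<open>prob_space.indep_var\<close> needs both of them to take
  values in the same type, which is not the case for an initial state and a path.
\<close>

definition indep_rv ::
  "'w measure \<Rightarrow> 'a measure \<Rightarrow> ('w \<Rightarrow> 'a) \<Rightarrow> 'b measure \<Rightarrow> ('w \<Rightarrow> 'b) \<Rightarrow> bool" where
  "indep_rv M A X B Y \<longleftrightarrow>
     X \<in> measurable M A \<and> Y \<in> measurable M B \<and>
     prob_space.indep_set M
       {X -` S \<inter> space M |S. S \<in> sets A} {Y -` S \<inter> space M |S. S \<in> sets B}"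

abbreviation path_space :: "(real \<Rightarrow> real) measure" where
  "path_space \<equiv> (\<Pi>\<^sub>M t\<in>{0..}. borel)"

definition noise_path :: "(real \<Rightarrow> 'w \<Rightarrow> real) \<Rightarrow> 'w \<Rightarrow> real \<Rightarrow> real" where
  "noise_path B \<omega> = (\<lambda>t\<in>{0..}. B t \<omega>)"

text \<open>
  The equations \<open>dq = p dt\<close> (on the torus) and \<open>dp = -\<gamma> p dt - F dt + \<sigma> dB\<close> on the time interval
  \<open>[0, S]\<close>, in integrated form.  The noise is additive, so no stochastic integral is needed and the
  equations are required to hold path by path.  \<open>F s \<omega>\<close> is the interaction term at time \<open>s\<close>.
\<close>

definition langevin ::
  "'w measure \<Rightarrow> real \<Rightarrow> real \<Rightarrow> real \<Rightarrow> (real \<Rightarrow> 'w \<Rightarrow> real) \<Rightarrow> (real \<Rightarrow> 'w \<Rightarrow> real)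
     \<Rightarrow> (real \<Rightarrow> 'w \<Rightarrow> real) \<Rightarrow> (real \<Rightarrow> 'w \<Rightarrow> real) \<Rightarrow> bool" where
  "langevin M S \<gamma> \<sigma> F B q p \<longleftrightarrow>
     (\<forall>t\<in>{0..S}. q t \<in> borel_measurable M \<and> p t \<in> borel_measurable M) \<and>
     (AE \<omega> in M.
        continuous_on {0..S} (\<lambda>t. p t \<omega>) \<and>
        (\<forall>t\<in>{0..S}.
           [q t \<omega> = q 0 \<omega> + integral {0..t} (\<lambda>s. p s \<omega>)] (rmod (2 * pi)) \<and>
           p t \<omega> = p 0 \<omega> - \<gamma> * integral {0..t} (\<lambda>s. p s \<omega>)
                    - integral {0..t} (\<lambda>s. F s \<omega>) + \<sigma> * B t \<omega>))"

definition particle_system ::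
  "'w measure \<Rightarrow> nat \<Rightarrow> real \<Rightarrow> real \<Rightarrow> real \<Rightarrow> (real \<Rightarrow> real) \<Rightarrow> (real \<times> real) measure
     \<Rightarrow> (nat \<Rightarrow> real \<Rightarrow> 'w \<Rightarrow> real) \<Rightarrow> (nat \<Rightarrow> real \<Rightarrow> 'w \<Rightarrow> real) \<Rightarrow> (nat \<Rightarrow> real \<Rightarrow> 'w \<Rightarrow> real) \<Rightarrow> bool" where
  "particle_system M N S \<gamma> \<sigma> W \<nu> B q p \<longleftrightarrow>
     prob_space M \<and>
     (\<forall>i<N. brownian_motion M (B i)) \<and>
     prob_space.indep_vars M (\<lambda>_. path_space) (\<lambda>i. noise_path (B i)) {..<N} \<and>
     prob_space.indep_vars M (\<lambda>_. phase_space) (\<lambda>i. state (q i) (p i) 0) {..<N} \<and>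
     (\<forall>i<N. distr M phase_space (state (q i) (p i) 0) = \<nu>) \<and>
     indep_rv M
       (\<Pi>\<^sub>M i\<in>{..<N}. phase_space) (\<lambda>\<omega>. \<lambda>i\<in>{..<N}. state (q i) (p i) 0 \<omega>)
       (\<Pi>\<^sub>M i\<in>{..<N}. path_space) (\<lambda>\<omega>. \<lambda>i\<in>{..<N}. noise_path (B i) \<omega>) \<and>
     (\<forall>i<N. langevin M S \<gamma> \<sigma>
        (\<lambda>s \<omega>. 1 / real N * (\<Sum>j<N. deriv W (q i s \<omega> - q j s \<omega>))) (B i) (q i) (p i))"

definition mckean_vlasov ::
  "'w measure \<Rightarrow> real \<Rightarrow> real \<Rightarrow> real \<Rightarrow> (real \<Rightarrow> real) \<Rightarrow> (real \<times> real \<Rightarrow> real)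
     \<Rightarrow> (real \<Rightarrow> 'w \<Rightarrow> real) \<Rightarrow> (real \<Rightarrow> 'w \<Rightarrow> real) \<Rightarrow> (real \<Rightarrow> 'w \<Rightarrow> real) \<Rightarrow> bool" where
  "mckean_vlasov M S \<gamma> \<sigma> W f0 B q p \<longleftrightarrow>
     brownian_motion M B \<and>
     distributed M phase_space (state q p 0) (\<lambda>z. ennreal (f0 z)) \<and>
     indep_rv M phase_space (state q p 0) path_space (noise_path B) \<and>
     langevin M S \<gamma> \<sigma>
       (\<lambda>s \<omega>. torus_conv_measure (deriv W) (distr M torus (\<lambda>\<omega>'. q s \<omega>' rmod (2 * pi))) (q s \<omega>))
       B q p"

definition smoothed_density ::
  "nat \<Rightarrow> (nat \<Rightarrow> real \<Rightarrow> 'w \<Rightarrow> real) \<Rightarrow> real \<Rightarrow> 'w \<Rightarrow> real \<Rightarrow> real \<Rightarrow> real" where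
  "smoothed_density N q \<epsilon> \<omega> x t = 1 / real N * (\<Sum>i<N. von_mises \<epsilon> (x - q i t \<omega>))"

end

theory Submission
  imports Defs
begin

text \<open>
  Replacing \<open>q\<^sub>i\<close> by \<open>x\<close> in \<open>W'(q\<^sub>i - q\<^sub>j)\<close> costs a multiple of \<open>\<bar>sin ((x - q\<^sub>i) / 2)\<bar>\<close>, a distance on the
  torus for which \<open>W'\<close> is Lipschitz, and mollifying \<open>W'\<close> by the von Mises density costs \<open>O(\<surd>\<epsilon>)\<close>.
  The particles with \<open>(sin ((x - q\<^sub>i) / 2))\<^sup>2 \<le> \<epsilon>\<close> therefore contribute \<open>O(\<surd>\<epsilon>)\<close> times
  \<open>\<rho>\<^sub>\<epsilon>\<close>, which is \<open>r\<^sub>1 \<rho>\<^sub>\<epsilon>\<close>; on the others the von Mises density is at most \<open>\<epsilon>\<close>, and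
  they make up \<open>r\<^sub>2\<close>.  Both bounds hold for every configuration of particles, hence in expectation.
\<close>

section \<open>Functions on the torus\<close>

lemma torus_fun_add_int:
  assumes "torus_fun g"
  shows "g (x + of_int n * (2 * pi)) = g x"
proof (induction n rule: int_induct[of _ 0])
  case (step1 i)
  then show ?case
    using assms[unfolded torus_fun_def, rule_format, of "x + of_int i * (2 * pi)"]
    by (simp add: algebra_simps)
next
  case (step2 i)
  then show ?case
    using assms[unfolded torus_fun_def, rule_format, of "x + of_int (i - 1) * (2 * pi)"]
    by (simp add: algebra_simps)
qed simp

lemma torus_fun_rcong:
  assumes "torus_fun g" "[x = y] (rmod (2 * pi))"
  shows "g x = g y"
  using assms torus_fun_add_int[OF assms(1), of x] by (auto simp: rcong_altdef)

lemma torus_fun_deriv: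
  assumes "torus_fun g" "\<And>x. g differentiable at x"
  shows "torus_fun (deriv g)"
  unfolding torus_fun_def
proof
  fix x
  have "(g has_real_derivative deriv g (x + 2 * pi)) (at (x + 2 * pi))"
    using assms(2) by (simp add: DERIV_deriv_iff_real_differentiable)
  then have "((\<lambda>y. g (y + 2 * pi)) has_real_derivative deriv g (x + 2 * pi)) (at x)"
    by (simp add: DERIV_shift)
  then have "(g has_real_derivative deriv g (x + 2 * pi)) (at x)"
    using assms(1) by (simp add: torus_fun_def)
  then show "deriv g (x + 2 * pi) = deriv g x"
    by (metis DERIV_imp_deriv)
qed

text \<open>With y = v / 2 and \<open>pi < 4\<close> one has |y| \<le> 2, where the Taylor remainder
  |y|^3 / 6 is at most (2/3) |y|. Hence |y| \<le> 3 |sin y|, and undoing the halving turns 3 into 6.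
  The constant is crude, but it only enters the Lipschitz constant of the next lemma.\<close>

lemma abs_le_abs_sin_half:
  fixes v :: real
  assumes "\<bar>v\<bar> \<le> pi"
  shows "\<bar>v\<bar> \<le> 6 * \<bar>sin (v / 2)\<bar>"
proof -
  define y where "y = v / 2"
  have y: "\<bar>y\<bar> \<le> 2"
    using assms pi_less_4 by (simp add: y_def)
  have "(\<Sum>m<3. sin_coeff m * y ^ m) = y"
    by (simp add: sin_coeff_def numeral_3_eq_3)
  then have "\<bar>sin y - y\<bar> \<le> \<bar>y\<bar> ^ 3 / 6"
    using Maclaurin_sin_bound[of y 3] by (simp add: fact_numeral)
  also have "\<bar>y\<bar> ^ 3 = \<bar>y\<bar>\<^sup>2 * \<bar>y\<bar>"
    by (simp add: power3_eq_cube power2_eq_square)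
  also have "\<bar>y\<bar>\<^sup>2 * \<bar>y\<bar> / 6 \<le> 2\<^sup>2 * \<bar>y\<bar> / 6"
    using y by (intro divide_right_mono mult_right_mono power_mono) auto
  finally have "\<bar>y\<bar> \<le> 3 * \<bar>sin y\<bar>"
    by (simp add: abs_if split: if_splits)
  then show ?thesis
    by (simp add: y_def)
qed

text \<open>The mean value inequality is applied not to a and b but to representatives that are as
  close on the line as the points are on the torus; for these the distance is controlled by the sine
  of half the difference.\<close>

lemma torus_fun_C1_lipschitz:
  assumes "torus_fun g" "g C1_differentiable_on UNIV"
  obtains L :: real where "L \<ge> 0" "\<And>a b. \<bar>g a - g b\<bar> \<le> L * \<bar>sin ((a - b) / 2)\<bar>"
proof -
  obtain D where D: "\<And>x. (g has_vector_derivative D x) (at x)" and cD: "continuous_on UNIV D"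
    using assms(2) by (auto simp: C1_differentiable_on_def)
  \<comment> \<open>The interval contains both representatives used below: \<open>a'\<close> lies in
    [0, 2 pi) and \<open>v\<close> in [-pi, pi), so \<open>a' - v\<close> lies between -pi and 3
    pi.\<close>
  have "compact (D ` {-pi..3 * pi})"
    by (intro compact_continuous_image continuous_on_subset[OF cD]) auto
  then obtain B where B: "\<And>x. x \<in> {-pi..3 * pi} \<Longrightarrow> \<bar>D x\<bar> \<le> B" "B > 0"
    by (fastforce dest: compact_imp_bounded simp: bounded_pos)
  have "\<bar>g a - g b\<bar> \<le> 6 * B * \<bar>sin ((a - b) / 2)\<bar>" for a b
  proof -
    define a' where "a' = a rmod (2 * pi)"
    \<comment> \<open>The shift by pi before and after the reduction selects the representative of a
      - b in [-pi, pi), which is where \<open>abs_le_abs_sin_half\<close> applies.\<close>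
    define v where "v = (a - b + pi) rmod (2 * pi) - pi"
    have a': "0 \<le> a'" "a' < 2 * pi" "g a' = g a"
      using torus_fun_rcong[OF assms(1), of a' a]
      by (auto simp: a'_def rmod_nonneg rmod_less intro: rcong_intros)
    have v: "-pi \<le> v" "v < pi"
      using rmod_nonneg[of "2 * pi" "a - b + pi"] rmod_less[of "2 * pi" "a - b + pi"]
      by (auto simp: v_def)
    have "[v = a - b + pi - pi] (rmod (2 * pi))"
      unfolding v_def by (intro rcong_intros)
    then have cv: "[v = a - b] (rmod (2 * pi))"
      by simp
    have "[a' - v = a - (a - b)] (rmod (2 * pi))"
      unfolding a'_def by (intro rcong_diff rcong_intros cv)
    then have b: "g (a' - v) = g b"
      using torus_fun_rcong[OF assms(1), of "a' - v" b] by simp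
    \<comment> \<open>A period of 2 pi flips the sign of sin (u / 2); only the absolute value is a
      function on the torus.\<close>
    have "torus_fun (\<lambda>u. \<bar>sin (u / 2)\<bar>)"
      by (simp add: torus_fun_def add_divide_distrib)
    then have s: "\<bar>sin (v / 2)\<bar> = \<bar>sin ((a - b) / 2)\<bar>"
      using torus_fun_rcong[OF _ cv] by blast
    have "norm (g a' - g (a' - v)) \<le> B * norm (a' - (a' - v))"
    proof (rule field_differentiable_bound)
      show "(g has_field_derivative D z) (at z within {-pi..3 * pi})" for z
        using D[of z]
        by (simp add: has_real_derivative_iff_has_vector_derivative has_vector_derivative_at_within)
    qed (use a' v B in auto)
    then have "\<bar>g a - g b\<bar> \<le> B * \<bar>v\<bar>"
      using a' b by simp
    also have "\<dots> \<le> B * (6 * \<bar>sin (v / 2)\<bar>)"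
      using v B by (intro mult_left_mono abs_le_abs_sin_half) auto
    finally show ?thesis
      using s by (simp add: mult_ac)
  qed
  with B(2) show thesis
    by (intro that[of "6 * B"]) auto
qed

section \<open>Integration over the torus\<close>

lemma torus_integral_eq_set_integral:
  "(LINT y|torus. g y) = (LINT y:{0..<2 * pi}|lborel. g y)"
  for g :: "real \<Rightarrow> real"
  by (simp add: torus_def integral_restrict_space set_lebesgue_integral_def)

lemma set_integrable_continuous_fundamental_domain:
  fixes g :: "real \<Rightarrow> real"
  assumes "continuous_on UNIV g"
  shows "set_integrable lborel {0..<2 * pi} g"
  by (rule set_integrable_subset[OF borel_integrable_atLeastAtMost'[of 0 "2 * pi"]])
     (auto intro: continuous_on_subset[OF assms])

lemma torus_integrable_continuous [intro]:
  fixes g :: "real \<Rightarrow> real"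
  assumes "continuous_on UNIV g"
  shows "integrable torus g"
  using set_integrable_continuous_fundamental_domain[OF assms]
  by (simp add: torus_def integrable_restrict_space set_integrable_def)

lemma torus_integral_eq_integral:
  fixes g :: "real \<Rightarrow> real"
  assumes "continuous_on UNIV g"
  shows "(LINT y|torus. g y) = integral {0..2 * pi} g"
proof -
  have "(LINT y|torus. g y) = integral {0..<2 * pi} g"
    unfolding torus_integral_eq_set_integral
    by (rule set_borel_integral_eq_integral)
       (rule set_integrable_continuous_fundamental_domain[OF assms])
  also have "\<dots> = integral {0..2 * pi} g"
    by (rule integral_spike_set; rule negligible_subset[of "{2 * pi}"]) auto
  finally show ?thesis .
qed

text \<open>The translation is first reduced to some \<open>d\<close> between 0 and 2 pi. The window
  from d to 2 pi + d is then cut at 2 pi, and its right piece is moved back by one period to fill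
  the gap from 0 to d.\<close>

lemma torus_integral_shift:
  fixes g :: "real \<Rightarrow> real"
  assumes "torus_fun g" "continuous_on UNIV g"
  shows "(LINT y|torus. g (y - c)) = (LINT y|torus. g y)"
proof -
  define d where "d = (- c) rmod (2 * pi)"
  have d: "0 \<le> d" "d \<le> 2 * pi"
    by (auto simp: d_def rmod_nonneg rmod_le)
  have ig: "g integrable_on {a..b}" for a b
    by (intro integrable_continuous_real continuous_on_subset[OF assms(2)]) auto
  have shift: "integral {a..b} (\<lambda>y. g (y + s)) = integral {a + s..b + s} g" for a b s
    using integral_shift_Icc_real[of a b g s] by (simp add: o_def add.commute)
  have "g (y - c) = g (y + d)" for y
  proof (rule torus_fun_rcong[OF assms(1)])
    have "[y + d = y + - c] (rmod (2 * pi))"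
      unfolding d_def by (intro rcong_intros)
    then show "[y - c = y + d] (rmod (2 * pi))"
      by (simp add: rcong_sym_iff)
  qed
  then have "(LINT y|torus. g (y - c)) = integral {0..2 * pi} (\<lambda>y. g (y + d))"
    by (simp add: torus_integral_eq_integral continuous_on_compose2[OF assms(2)] continuous_intros)
  also have "\<dots> = integral {d..2 * pi} g + integral {2 * pi..2 * pi + d} g"
    using d ig[of d "2 * pi + d"]
      Henstock_Kurzweil_Integration.integral_combine[of d "2 * pi" "2 * pi + d" g]
    by (simp add: shift)
  also have "integral {2 * pi..2 * pi + d} g = integral {0..d} (\<lambda>y. g (y + 2 * pi))"
    by (simp add: shift add.commute)
  also have "(\<lambda>y. g (y + 2 * pi)) = g"
    using assms(1) by (simp add: torus_fun_def)
  also have "integral {d..2 * pi} g + integral {0..d} g = integral {0..2 * pi} g"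
    using d ig[of 0 "2 * pi"] Henstock_Kurzweil_Integration.integral_combine[of 0 d "2 * pi" g]
    by simp
  finally show ?thesis
    by (simp add: torus_integral_eq_integral assms)
qed

section \<open>The von Mises density\<close>

text \<open>The mass near the origin suffices: for y between 0 and \<epsilon>, |sin (y / 2)| \<le>
  \<epsilon> / 2 makes the exponent at least -1/2, so by exp u \<ge> 1 + u the integrand is at least
  1/2. Since this integral is the denominator of the density, a lower bound of order \<epsilon>
  yields the upper bounds below.\<close>

lemma von_mises_normalisation_ge:
  assumes "0 < \<epsilon>" "\<epsilon> \<le> 1"
  shows "\<epsilon> / 2 \<le> (LINT y|torus. exp (- (sin (y / 2))\<^sup>2 / (\<epsilon>\<^sup>2 / 2)))"
proof -
  let ?g = "\<lambda>y :: real. exp (- (sin (y / 2))\<^sup>2 / (\<epsilon>\<^sup>2 / 2))"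
  have cont: "continuous_on S ?g" for S
    using assms by (intro continuous_intros) auto
  have "1 / 2 \<le> ?g y" if "y \<in> {0..\<epsilon>}" for y
  proof -
    have "\<bar>sin (y / 2)\<bar> \<le> \<bar>\<epsilon> / 2\<bar>"
      using abs_sin_x_le_abs_x[of "y / 2"] that by auto
    then have "(sin (y / 2))\<^sup>2 \<le> (\<epsilon> / 2)\<^sup>2"
      by (simp only: abs_le_square_iff)
    then have "(sin (y / 2))\<^sup>2 / (\<epsilon>\<^sup>2 / 2) \<le> 1 / 2"
      using assms by (simp add: field_simps power2_eq_square)
    then have "1 / 2 \<le> 1 + (- (sin (y / 2))\<^sup>2 / (\<epsilon>\<^sup>2 / 2))"
      by simp
    then show ?thesis
      using exp_ge_add_one_self order_trans by blast
  qed
  then have "integral {0..\<epsilon>} (\<lambda>_. 1 / 2) \<le> integral {0..\<epsilon>} ?g"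
    by (intro integral_le integrable_continuous_real cont) auto
  also have "\<dots> \<le> integral {0..2 * pi} ?g"
    using assms pi_gt3 by (intro integral_subset_le integrable_continuous_real cont) auto
  finally show ?thesis
    using assms(1) unfolding torus_integral_eq_integral[OF cont] by simp
qed

lemma torus_fun_von_mises: "torus_fun (von_mises \<epsilon>)"
  by (simp add: torus_fun_def von_mises_def add_divide_distrib)

lemma continuous_on_von_mises [continuous_intros]:
  assumes "\<epsilon> > 0" "continuous_on S h"
  shows "continuous_on S (\<lambda>x. von_mises \<epsilon> (h x))"
proof -
  have "continuous_on UNIV (\<lambda>x. exp (- (sin (x / 2))\<^sup>2 / (\<epsilon>\<^sup>2 / 2)) *
      inverse (LINT y|torus. exp (- (sin (y / 2))\<^sup>2 / (\<epsilon>\<^sup>2 / 2))))"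
    using assms(1) by (intro continuous_intros) auto
  then have "continuous_on UNIV (von_mises \<epsilon>)"
    by (simp only: von_mises_def[abs_def] divide_inverse)
  then show ?thesis
    by (rule continuous_on_compose2[OF _ assms(2)]) simp
qed

lemma von_mises_measurable [measurable]: "von_mises \<epsilon> \<in> borel_measurable borel"
  unfolding von_mises_def by measurable

lemma von_mises_pos:
  assumes "0 < \<epsilon>" "\<epsilon> \<le> 1"
  shows "von_mises \<epsilon> x > 0"
  using von_mises_normalisation_ge[OF assms] assms by (simp add: von_mises_def)

lemma torus_integral_von_mises:
  assumes "0 < \<epsilon>" "\<epsilon> \<le> 1"
  shows "(LINT y|torus. von_mises \<epsilon> (y - q)) = 1"
proof -
  have "(LINT y|torus. von_mises \<epsilon> (y - q)) = (LINT y|torus. von_mises \<epsilon> y)"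
    using assms by (intro torus_integral_shift torus_fun_von_mises continuous_intros)
  also have "\<dots> = 1"
    using von_mises_normalisation_ge[OF assms] assms by (simp add: von_mises_def)
  finally show ?thesis .
qed

text \<open>Beyond the threshold the exponent is below -u with u = 2 / \<epsilon>, and exp u \<ge>
  u^2 / 2 bounds the numerator by \<epsilon>^2 / 2. Dividing by the normalisation, at least
  \<epsilon> / 2, leaves \<epsilon>. The true decay is exponential; one power of \<epsilon> is
  enough here.\<close>

lemma von_mises_le_far:
  assumes "0 < \<epsilon>" "\<epsilon> \<le> 1" "(sin (x / 2))\<^sup>2 > \<epsilon>"
  shows "von_mises \<epsilon> x \<le> \<epsilon>"
proof -
  have "2 / \<epsilon> \<le> (sin (x / 2))\<^sup>2 / (\<epsilon>\<^sup>2 / 2)"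
    using assms by (simp add: field_simps power2_eq_square)
  moreover have "(2 / \<epsilon>)\<^sup>2 / 2 \<le> exp (2 / \<epsilon>)"
  proof -
    have "0 \<le> 2 / \<epsilon>"
      using assms by simp
    then show ?thesis
      using exp_lower_Taylor_quadratic[of "2 / \<epsilon>"] by linarith
  qed
  ultimately have "(2 / \<epsilon>)\<^sup>2 / 2 \<le> exp ((sin (x / 2))\<^sup>2 / (\<epsilon>\<^sup>2 / 2))"
    by (meson exp_le_cancel_iff order_trans)
  then have "inverse (exp ((sin (x / 2))\<^sup>2 / (\<epsilon>\<^sup>2 / 2))) \<le> inverse ((2 / \<epsilon>)\<^sup>2 / 2)"
    using assms by (intro le_imp_inverse_le) auto
  then have "exp (- (sin (x / 2))\<^sup>2 / (\<epsilon>\<^sup>2 / 2)) \<le> \<epsilon>\<^sup>2 / 2"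
    by (simp add: exp_minus[symmetric] power_divide)
  then have "von_mises \<epsilon> x \<le> (\<epsilon>\<^sup>2 / 2) / (\<epsilon> / 2)"
    unfolding von_mises_def using von_mises_normalisation_ge[OF assms(1,2)] assms(1)
    by (intro frac_le) auto
  then show ?thesis
    using assms(1) by (simp add: power2_eq_square)
qed

text \<open>Inside the threshold the sine is at most sqrt \<epsilon>; outside it is at most 1 and
  the density is at most \<epsilon>. Adding the two bounds gives an estimate free of case
  distinctions, ready to be integrated.\<close>

lemma abs_sin_half_mult_von_mises_le:
  assumes "0 < \<epsilon>" "\<epsilon> \<le> 1"
  shows "\<bar>sin (x / 2)\<bar> * von_mises \<epsilon> x \<le> sqrt \<epsilon> * von_mises \<epsilon> x + \<epsilon>"
proof (cases "(sin (x / 2))\<^sup>2 \<le> \<epsilon>")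
  case True
  then have "\<bar>sin (x / 2)\<bar> \<le> sqrt \<epsilon>"
    by (metis real_sqrt_abs real_sqrt_le_iff)
  then have "\<bar>sin (x / 2)\<bar> * von_mises \<epsilon> x \<le> sqrt \<epsilon> * von_mises \<epsilon> x"
    using von_mises_pos[OF assms] by (simp add: less_imp_le mult_right_mono)
  then show ?thesis
    using assms by simp
next
  case False
  have "\<bar>sin (x / 2)\<bar> * von_mises \<epsilon> x \<le> 1 * von_mises \<epsilon> x"
    using von_mises_pos[OF assms, of x] by (intro mult_right_mono) auto
  also have "\<dots> \<le> \<epsilon>"
    using von_mises_le_far[OF assms, of x] False by simp
  also have "\<dots> \<le> sqrt \<epsilon> * von_mises \<epsilon> x + \<epsilon>"
    using von_mises_pos[OF assms, of x] assms by simp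
  finally show ?thesis .
qed

section \<open>The remainders\<close>

text \<open>The density has mass 1, so \<open>g (x - q)\<close> can be put under the integral as a
  constant factor. What remains is the Lipschitz increment of \<open>g\<close> weighted by the
  density.\<close>

lemma torus_conv_von_mises_error:
  assumes g: "continuous_on UNIV g" "L \<ge> 0" "\<And>a b. \<bar>g a - g b\<bar> \<le> L * \<bar>sin ((a - b) / 2)\<bar>"
    and \<epsilon>: "0 < \<epsilon>" "\<epsilon> \<le> 1"
  shows "\<bar>g (x - q) - torus_conv g (\<lambda>y. von_mises \<epsilon> (y - q)) x\<bar> \<le> 9 * L * sqrt \<epsilon>"
proof -
  let ?w = "\<lambda>y. von_mises \<epsilon> (y - q)"
  have cg: "continuous_on UNIV (\<lambda>y. g (x - y))"
    by (intro continuous_on_compose2[OF g(1)] continuous_intros) auto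
  have w: "integrable torus ?w"
    using \<epsilon> by (intro torus_integrable_continuous continuous_intros)
  have gw: "integrable torus (\<lambda>y. g (x - y) * ?w y)"
    using \<epsilon> by (intro torus_integrable_continuous continuous_intros cg)
  have "g (x - q) - torus_conv g ?w x = (LINT y|torus. g (x - q) * ?w y) - (LINT y|torus. g (x - y) * ?w y)"
    by (simp add: torus_conv_def torus_integral_von_mises \<epsilon>)
  also have "\<dots> = (LINT y|torus. g (x - q) * ?w y - g (x - y) * ?w y)"
    using w gw by simp
  also have "\<bar>\<dots>\<bar> \<le> (LINT y|torus. L * (sqrt \<epsilon> * ?w y + \<epsilon>))"
  proof (rule integral_abs_bound_integral)
    show "integrable torus (\<lambda>y. g (x - q) * ?w y - g (x - y) * ?w y)"
      using w gw by simp
    show "integrable torus (\<lambda>y. L * (sqrt \<epsilon> * ?w y + \<epsilon>))"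
      using \<epsilon> by (intro torus_integrable_continuous continuous_intros)
    fix y
    have "\<bar>g (x - q) * ?w y - g (x - y) * ?w y\<bar> = \<bar>g (x - q) - g (x - y)\<bar> * ?w y"
      using von_mises_pos[OF \<epsilon>, of "y - q"] by (simp add: left_diff_distrib[symmetric] abs_mult)
    \<comment> \<open>The arguments of \<open>g\<close> differ by (x - q) - (x - y) = y - q, which
      is exactly the argument of the density, so the previous lemma applies.\<close>
    also have "\<dots> \<le> L * \<bar>sin ((y - q) / 2)\<bar> * ?w y"
      using g(3)[of "x - q" "x - y"] von_mises_pos[OF \<epsilon>, of "y - q"]
      by (intro mult_right_mono) auto
    also have "\<dots> \<le> L * (sqrt \<epsilon> * ?w y + \<epsilon>)"
      using abs_sin_half_mult_von_mises_le[OF \<epsilon>, of "y - q"] g(2)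
      by (simp add: mult.assoc mult_left_mono)
    finally show "\<bar>g (x - q) * ?w y - g (x - y) * ?w y\<bar> \<le> L * (sqrt \<epsilon> * ?w y + \<epsilon>)" .
  qed
  also have "\<dots> = L * (sqrt \<epsilon> + 2 * pi * \<epsilon>)"
  proof -
    have "integrable torus (\<lambda>_. \<epsilon>)"
      by (intro torus_integrable_continuous continuous_intros)
    moreover have "(LINT y|torus. \<epsilon>) = 2 * pi * \<epsilon>"
      by (subst torus_integral_eq_integral) auto
    ultimately show ?thesis
      using w torus_integral_von_mises[OF \<epsilon>, of q]
      by (simp only: integral_mult_right_zero Bochner_Integration.integral_add
          integrable_mult_right mult_1_right)
  qed
  \<comment> \<open>The length 2 pi of the circle is below 8 and \<epsilon> \<le> sqrt \<epsilon>;
    hence the total 1 + 8 = 9 in the statement.\<close>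
  also have "\<dots> \<le> L * (sqrt \<epsilon> + 8 * sqrt \<epsilon>)"
  proof -
    have "\<epsilon> \<le> sqrt \<epsilon>"
      using \<epsilon> by (simp add: real_le_rsqrt power2_eq_square mult_left_le)
    then have "2 * pi * \<epsilon> \<le> 8 * sqrt \<epsilon>"
      using pi_less_4 \<epsilon> by (intro mult_mono) auto
    then show ?thesis
      using g(2) by (intro mult_left_mono) auto
  qed
  finally show ?thesis
    by simp
qed

text \<open>Here \<open>z\<close> stands for the position of a particle and \<open>x\<close> for the
  point of observation. By linearity of the convolution the error is an average over j of errors for
  a single kernel.\<close>

lemma drift_error:
  fixes q :: "nat \<Rightarrow> real"
  assumes g: "continuous_on UNIV g" "L \<ge> 0" "\<And>a b. \<bar>g a - g b\<bar> \<le> L * \<bar>sin ((a - b) / 2)\<bar>"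
    and \<epsilon>: "0 < \<epsilon>" "\<epsilon> \<le> 1" and N: "N > 0"
  shows "\<bar>1 / real N * (\<Sum>j<N. g (z - q j)) -
            torus_conv g (\<lambda>y. 1 / real N * (\<Sum>j<N. von_mises \<epsilon> (y - q j))) x\<bar>
         \<le> L * \<bar>sin ((x - z) / 2)\<bar> + 9 * L * sqrt \<epsilon>"
proof -
  let ?K = "\<lambda>j. torus_conv g (\<lambda>y. von_mises \<epsilon> (y - q j)) x"
  have cg: "continuous_on UNIV (\<lambda>y. g (x - y))"
    by (intro continuous_on_compose2[OF g(1)] continuous_intros) auto
  have "integrable torus (\<lambda>y. g (x - y) * von_mises \<epsilon> (y - q j))" for j
    using \<epsilon> by (intro torus_integrable_continuous continuous_intros cg)
  then have "torus_conv g (\<lambda>y. 1 / real N * (\<Sum>j<N. von_mises \<epsilon> (y - q j))) x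
      = 1 / real N * (\<Sum>j<N. ?K j)"
    by (simp add: torus_conv_def sum_distrib_left)
  then have "\<bar>1 / real N * (\<Sum>j<N. g (z - q j)) -
      torus_conv g (\<lambda>y. 1 / real N * (\<Sum>j<N. von_mises \<epsilon> (y - q j))) x\<bar>
      = 1 / real N * \<bar>\<Sum>j<N. g (z - q j) - ?K j\<bar>"
    by (simp only: sum_subtractf right_diff_distrib[symmetric] abs_mult) simp
  also have "\<dots> \<le> 1 / real N * (\<Sum>j<N. \<bar>g (z - q j) - ?K j\<bar>)"
    by (intro mult_left_mono sum_abs) auto
  also have "\<dots> \<le> 1 / real N * (\<Sum>j<N. L * \<bar>sin ((x - z) / 2)\<bar> + 9 * L * sqrt \<epsilon>)"
  proof (intro mult_left_mono sum_mono)
    fix j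
    \<comment> \<open>The intermediate value \<open>g (x - q j)\<close> separates the cost of moving
      from z to x from the cost of mollifying.\<close>
    have "\<bar>g (z - q j) - ?K j\<bar> \<le> \<bar>g (x - q j) - g (z - q j)\<bar> + \<bar>g (x - q j) - ?K j\<bar>"
      by linarith
    also have "\<dots> \<le> L * \<bar>sin ((x - z) / 2)\<bar> + 9 * L * sqrt \<epsilon>"
      using g(3)[of "x - q j" "z - q j"] torus_conv_von_mises_error[OF g \<epsilon>, of x "q j"]
      by (intro add_mono) auto
    finally show "\<bar>g (z - q j) - ?K j\<bar> \<le> L * \<bar>sin ((x - z) / 2)\<bar> + 9 * L * sqrt \<epsilon>" .
  qed auto
  finally show ?thesis
    using N by simp
qed

lemma torus_conv_measurable:
  assumes [measurable]: "g \<in> borel_measurable borel" "case_prod h \<in> borel_measurable (M \<Otimes>\<^sub>M lborel)"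
  shows "(\<lambda>\<omega>. torus_conv g (h \<omega>) x) \<in> borel_measurable M"
  \<comment> \<open>Over the sigma-finite \<open>lborel\<close>, integrals depending on a parameter
    are measurable in it; the fundamental domain becomes an indicator.\<close>
  unfolding torus_conv_def torus_integral_eq_set_integral set_lebesgue_integral_def
  by measurable

text \<open>All estimates are deterministic and hold at each outcome; the probability measure enters
  through measurability and through integrating a constant bound. The factor 10 is 9 from mollifying
  plus 1 from moving q_i to x.\<close>

lemma drift_decomposition:
  fixes M :: "'w measure" and q :: "nat \<Rightarrow> real \<Rightarrow> 'w \<Rightarrow> real"
  assumes tg: "torus_fun g"
    and g: "continuous_on UNIV g" "L \<ge> 0" "\<And>a b. \<bar>g a - g b\<bar> \<le> L * \<bar>sin ((a - b) / 2)\<bar>"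
    and "prob_space M" and \<epsilon>: "0 < \<epsilon>" "\<epsilon> \<le> 1" and N: "N > 0"
    and q_meas: "\<forall>t\<in>S. \<forall>i<N. q i t \<in> borel_measurable M"
  shows "\<exists>r1 r2 :: real \<Rightarrow> real \<Rightarrow> 'w \<Rightarrow> real.
    \<forall>t\<in>S.
      (\<forall>\<omega>\<in>space M. torus_fun (\<lambda>x. r1 x t \<omega>) \<and> torus_fun (\<lambda>x. r2 x t \<omega>)) \<and>
      (\<forall>x.
        r1 x t \<in> borel_measurable M \<and> integrable M (r2 x t) \<and>
        (\<forall>\<omega>\<in>space M.
          1 / real N * (\<Sum>i<N. (1 / real N * (\<Sum>j<N. g (q i t \<omega> - q j t \<omega>)))
                                * von_mises \<epsilon> (x - q i t \<omega>)) =
          torus_conv g (\<lambda>y. smoothed_density N q \<epsilon> \<omega> y t) x * smoothed_density N q \<epsilon> \<omega> x t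
            + r1 x t \<omega> * smoothed_density N q \<epsilon> \<omega> x t + r2 x t \<omega>) \<and>
        (\<forall>\<omega>\<in>space M. \<bar>r1 x t \<omega>\<bar> \<le> 10 * L * sqrt \<epsilon>) \<and>
        (LINT \<omega>|M. \<bar>r2 x t \<omega>\<bar>) \<le> 10 * L * \<epsilon>)"
proof -
  have [measurable]: "g \<in> borel_measurable borel"
    using g(1) by (rule borel_measurable_continuous_onI)
  interpret prob_space M by fact
  define w where "w = (\<lambda>i x t \<omega>. von_mises \<epsilon> (x - q i t \<omega>))"
  define \<rho> where "\<rho> = (\<lambda>x t \<omega>. smoothed_density N q \<epsilon> \<omega> x t)"
  define V where "V = (\<lambda>x t \<omega>. torus_conv g (\<lambda>y. \<rho> y t \<omega>) x)"
  \<comment> \<open>The error made at particle i when its drift is replaced by the mollified drift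
    \<open>V\<close> at x; the remainders are the average of \<open>c\<close> times
    \<open>w\<close>, split by \<open>near\<close>.\<close>
  define c where "c = (\<lambda>i x t \<omega>. 1 / real N * (\<Sum>j<N. g (q i t \<omega> - q j t \<omega>)) - V x t \<omega>)"
  define near where "near = (\<lambda>i x t \<omega>. of_bool ((sin ((x - q i t \<omega>) / 2))\<^sup>2 \<le> \<epsilon>) :: real)"
  \<comment> \<open>Dividing by the density is legitimate because the von Mises density is strictly
    positive everywhere. The quotient is a weighted mean of the errors of near particles, with far
    particles counting as zero, so it inherits their bound.\<close>
  define r1 where "r1 = (\<lambda>x t \<omega>. (1 / real N * (\<Sum>i<N. near i x t \<omega> * (c i x t \<omega> * w i x t \<omega>))) / \<rho> x t \<omega>)"
  define r2 where "r2 = (\<lambda>x t \<omega>. 1 / real N * (\<Sum>i<N. (1 - near i x t \<omega>) * (c i x t \<omega> * w i x t \<omega>)))"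
  have w_pos: "w i x t \<omega> > 0" for i x t \<omega>
    by (simp add: w_def von_mises_pos \<epsilon>)
  have \<rho>_eq: "\<rho> x t \<omega> = 1 / real N * (\<Sum>i<N. w i x t \<omega>)" for x t \<omega>
    by (simp add: \<rho>_def w_def smoothed_density_def)
  have \<rho>_pos: "\<rho> x t \<omega> > 0" for x t \<omega>
    unfolding \<rho>_eq using N by (intro mult_pos_pos sum_pos w_pos) auto
  have decomposition: "1 / real N * (\<Sum>i<N. (1 / real N * (\<Sum>j<N. g (q i t \<omega> - q j t \<omega>))) * w i x t \<omega>) =
      V x t \<omega> * \<rho> x t \<omega> + r1 x t \<omega> * \<rho> x t \<omega> + r2 x t \<omega>" for x t \<omega>
  proof -
    have "r1 x t \<omega> * \<rho> x t \<omega> = 1 / real N * (\<Sum>i<N. near i x t \<omega> * (c i x t \<omega> * w i x t \<omega>))"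
      using \<rho>_pos[of x t \<omega>] by (simp add: r1_def)
    moreover have "(\<Sum>i<N. near i x t \<omega> * (c i x t \<omega> * w i x t \<omega>)) +
        (\<Sum>i<N. (1 - near i x t \<omega>) * (c i x t \<omega> * w i x t \<omega>)) = (\<Sum>i<N. c i x t \<omega> * w i x t \<omega>)"
      by (simp only: sum.distrib[symmetric] distrib_right[symmetric]) simp
    ultimately have "r1 x t \<omega> * \<rho> x t \<omega> + r2 x t \<omega> = 1 / real N * (\<Sum>i<N. c i x t \<omega> * w i x t \<omega>)"
      by (simp only: r2_def distrib_left[symmetric])
    also have "\<dots> = 1 / real N * (\<Sum>i<N. (1 / real N * (\<Sum>j<N. g (q i t \<omega> - q j t \<omega>))) * w i x t \<omega>)
        - V x t \<omega> * \<rho> x t \<omega>"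
      unfolding c_def \<rho>_eq left_diff_distrib sum_subtractf sum_distrib_left[symmetric]
      by (simp only: right_diff_distrib mult.left_commute[of "V x t \<omega>"])
    finally show ?thesis
      by simp
  qed
  have c_le: "\<bar>c i x t \<omega>\<bar> \<le> L * \<bar>sin ((x - q i t \<omega>) / 2)\<bar> + 9 * L * sqrt \<epsilon>" for i x t \<omega>
    unfolding c_def V_def \<rho>_def smoothed_density_def by (rule drift_error[OF g \<epsilon> N])
  have r1_le: "\<bar>r1 x t \<omega>\<bar> \<le> 10 * L * sqrt \<epsilon>" for x t \<omega>
  proof -
    have "\<bar>near i x t \<omega> * (c i x t \<omega> * w i x t \<omega>)\<bar> \<le> 10 * L * sqrt \<epsilon> * w i x t \<omega>" for i
    proof (cases "(sin ((x - q i t \<omega>) / 2))\<^sup>2 \<le> \<epsilon>")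
      case True
      then have "\<bar>sin ((x - q i t \<omega>) / 2)\<bar> \<le> sqrt \<epsilon>"
        by (metis real_sqrt_abs real_sqrt_le_iff)
      then have "L * \<bar>sin ((x - q i t \<omega>) / 2)\<bar> \<le> L * sqrt \<epsilon>"
        using g(2) by (rule mult_left_mono)
      then have "\<bar>c i x t \<omega>\<bar> \<le> 10 * L * sqrt \<epsilon>"
        using c_le[of i x t \<omega>] by linarith
      then have "\<bar>c i x t \<omega>\<bar> * w i x t \<omega> \<le> 10 * L * sqrt \<epsilon> * w i x t \<omega>"
        using w_pos[of i x t \<omega>] by (intro mult_right_mono) auto
      then show ?thesis
        using True w_pos[of i x t \<omega>] by (simp add: near_def abs_mult)
    qed (use g(2) \<epsilon> w_pos[of i x t \<omega>] in \<open>auto simp: near_def\<close>)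
    then have "\<bar>\<Sum>i<N. near i x t \<omega> * (c i x t \<omega> * w i x t \<omega>)\<bar> \<le> (\<Sum>i<N. 10 * L * sqrt \<epsilon> * w i x t \<omega>)"
      by (intro order_trans[OF sum_abs] sum_mono)
    then have "\<bar>1 / real N * (\<Sum>i<N. near i x t \<omega> * (c i x t \<omega> * w i x t \<omega>))\<bar> \<le> 10 * L * sqrt \<epsilon> * \<rho> x t \<omega>"
      using N by (simp add: \<rho>_eq abs_mult sum_distrib_left[symmetric] divide_right_mono)
    then show ?thesis
      using \<rho>_pos[of x t \<omega>] by (simp only: r1_def abs_divide abs_of_pos pos_divide_le_eq)
  qed
  have r2_le: "\<bar>r2 x t \<omega>\<bar> \<le> 10 * L * \<epsilon>" for x t \<omega>
  proof -
    have "\<bar>(1 - near i x t \<omega>) * (c i x t \<omega> * w i x t \<omega>)\<bar> \<le> 10 * L * \<epsilon>" for i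
    proof (cases "(sin ((x - q i t \<omega>) / 2))\<^sup>2 \<le> \<epsilon>")
      case False
      \<comment> \<open>For far particles no smallness of \<open>c\<close> is needed: sin and sqrt
        \<epsilon> are bounded by 1, and the factor \<epsilon> comes from the density.\<close>
      have "L * \<bar>sin ((x - q i t \<omega>) / 2)\<bar> \<le> L * 1" "L * sqrt \<epsilon> \<le> L * 1"
        using \<epsilon> by (intro mult_left_mono g(2); simp)+
      then have "\<bar>c i x t \<omega>\<bar> \<le> 10 * L"
        using c_le[of i x t \<omega>] by linarith
      moreover have "w i x t \<omega> \<le> \<epsilon>"
        using von_mises_le_far[OF \<epsilon>] False by (simp add: w_def)
      ultimately have "\<bar>c i x t \<omega>\<bar> * w i x t \<omega> \<le> 10 * L * \<epsilon>"
        using w_pos[of i x t \<omega>] g(2) by (intro mult_mono) auto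
      then show ?thesis
        using False w_pos[of i x t \<omega>] by (simp add: near_def abs_mult)
    qed (use g(2) \<epsilon> in \<open>auto simp: near_def\<close>)
    then have "\<bar>\<Sum>i<N. (1 - near i x t \<omega>) * (c i x t \<omega> * w i x t \<omega>)\<bar> \<le> (\<Sum>i<N. 10 * L * \<epsilon>)"
      by (intro order_trans[OF sum_abs] sum_mono)
    then show ?thesis
      using N by (simp add: r2_def abs_mult field_simps)
  qed
  have periodic: "w i (x + 2 * pi) t \<omega> = w i x t \<omega>" "V (x + 2 * pi) t \<omega> = V x t \<omega>"
    "near i (x + 2 * pi) t \<omega> = near i x t \<omega>" for i x t \<omega>
  proof -
    \<comment> \<open>The point x enters \<open>w\<close>, \<open>V\<close> and \<open>near\<close>
      only through differences x - y, so each inherits its period from a function on the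
      torus.\<close>
    have shift: "x + 2 * pi - y = x - y + 2 * pi" for y
      by simp
    show "w i (x + 2 * pi) t \<omega> = w i x t \<omega>"
      using torus_fun_von_mises[of \<epsilon>] by (simp only: w_def torus_fun_def shift)
    show "V (x + 2 * pi) t \<omega> = V x t \<omega>"
      using tg by (simp only: V_def torus_fun_def torus_conv_def shift)
    show "near i (x + 2 * pi) t \<omega> = near i x t \<omega>"
      by (simp only: near_def shift) (simp add: add_divide_distrib)
  qed
  have torus_r: "torus_fun (\<lambda>x. r1 x t \<omega>)" "torus_fun (\<lambda>x. r2 x t \<omega>)" for t \<omega>
    by (simp_all add: torus_fun_def r1_def r2_def c_def \<rho>_eq periodic)
  have r_meas: "r1 x t \<in> borel_measurable M" "r2 x t \<in> borel_measurable M"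
    if t: "t \<in> S" for x t
  proof -
    note [measurable] = q_meas[rule_format, OF t]
    have w_meas [measurable]: "w i x t \<in> borel_measurable M" if "i < N" for i x
      unfolding w_def using that by measurable
    have [measurable]: "(\<lambda>\<omega>. \<rho> x t \<omega>) \<in> borel_measurable M" for x
      unfolding \<rho>_eq by measurable
    \<comment> \<open>Joint measurability is required because \<open>V\<close> integrates the
      density over y at a fixed outcome.\<close>
    have "(\<lambda>(\<omega>, y). \<rho> y t \<omega>) \<in> borel_measurable (M \<Otimes>\<^sub>M lborel)"
      unfolding \<rho>_eq w_def by measurable
    then have [measurable]: "(\<lambda>\<omega>. V x t \<omega>) \<in> borel_measurable M"
      unfolding V_def by (intro torus_conv_measurable) auto
    have [measurable]: "(\<lambda>\<omega>. c i x t \<omega>) \<in> borel_measurable M" if "i < N" for i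
      unfolding c_def using that by measurable
    have [measurable]: "(\<lambda>\<omega>. near i x t \<omega>) \<in> borel_measurable M" if "i < N" for i
      unfolding near_def using that by measurable
    show "r1 x t \<in> borel_measurable M" "r2 x t \<in> borel_measurable M"
      unfolding r1_def r2_def by measurable
  qed
  have r2_int: "integrable M (r2 x t)" if "t \<in> S" for x t
    using r2_le by (intro integrable_const_bound[where B = "10 * L * \<epsilon>"] r_meas that) auto
  have r2_mean: "(LINT \<omega>|M. \<bar>r2 x t \<omega>\<bar>) \<le> 10 * L * \<epsilon>" if "t \<in> S" for x t
    using r2_int[OF that] r2_le by (intro integral_le_const) auto
  show ?thesis
    by (intro exI[of _ r1] exI[of _ r2] ballI conjI allI
        decomposition[unfolded w_def V_def \<rho>_def] r1_le torus_r r_meas r2_int r2_mean)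
qed

theorem proposition3p5:
  shows "\<exists>(\<theta>0::real) (\<beta>::real \<Rightarrow> real).
    (\<forall>\<theta>>\<theta>0. \<beta> \<theta> > 0) \<and>
    (\<forall>T t0 \<gamma> \<sigma> W. T > 0 \<and> t0 > 0 \<and> \<gamma> > 0 \<and> \<sigma> > 0 \<and> torus_C2 W \<longrightarrow>
      (\<exists>C1. \<forall>f0. initial_density f0 \<longrightarrow>
        (\<exists>C2. \<forall>(M' :: 'v measure) B' q' p' \<theta> \<epsilon> N (M :: 'w measure) B q p.
          mckean_vlasov M' t0 \<gamma> \<sigma> W f0 B' q' p' \<and>
          \<theta> > \<theta>0 \<and> 0 < \<epsilon> \<and> \<epsilon> \<le> 1 \<and> real N * \<epsilon> powr \<theta> = 1 \<and>
          particle_system M N T \<gamma> \<sigma> W (distr M' phase_space (state q' p' t0)) B q p \<longrightarrow>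
          (\<exists>r1 r2 :: real \<Rightarrow> real \<Rightarrow> 'w \<Rightarrow> real.
            \<forall>t\<in>{0..T}.
              (\<forall>\<omega>\<in>space M. torus_fun (\<lambda>x. r1 x t \<omega>) \<and> torus_fun (\<lambda>x. r2 x t \<omega>)) \<and>
              (\<forall>x.
                r1 x t \<in> borel_measurable M \<and> integrable M (r2 x t) \<and>
                (\<forall>\<omega>\<in>space M.
                  1 / real N * (\<Sum>i<N. (1 / real N * (\<Sum>j<N. deriv W (q i t \<omega> - q j t \<omega>)))
                                        * von_mises \<epsilon> (x - q i t \<omega>)) =
                  torus_conv (deriv W) (\<lambda>y. smoothed_density N q \<epsilon> \<omega> y t) x
                      * smoothed_density N q \<epsilon> \<omega> x t
                    + r1 x t \<omega> * smoothed_density N q \<epsilon> \<omega> x t + r2 x t \<omega>) \<and>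
                (\<forall>\<omega>\<in>space M. \<bar>r1 x t \<omega>\<bar> \<le> C1 * sqrt \<epsilon>) \<and>
                (LINT \<omega>|M. \<bar>r2 x t \<omega>\<bar>) \<le> C2 * (sqrt \<epsilon> + \<epsilon> powr \<beta> \<theta>))))))"
\<comment> \<open>The remainder \<open>r2\<close> is of order \<epsilon>, which is \<epsilon> to the
  power \<beta> with \<beta> = 1, and this holds for every positive \<theta>; hence the witnesses 0
  and 1.\<close>
proof (rule exI[of _ 0], rule exI[of _ "\<lambda>_. 1"], intro conjI allI impI, goal_cases)
  case (2 T t0 \<gamma> \<sigma> W)
  then have W: "torus_fun W" "W C1_differentiable_on UNIV" "deriv W C1_differentiable_on UNIV"
    by (auto simp: torus_C2_def)
  have tW': "torus_fun (deriv W)"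
    using W(1,2) by (intro torus_fun_deriv) (auto simp: C1_differentiable_on_eq)
  obtain L where L: "L \<ge> 0" "\<And>a b. \<bar>deriv W a - deriv W b\<bar> \<le> L * \<bar>sin ((a - b) / 2)\<bar>"
    using torus_fun_C1_lipschitz[OF tW' W(3)] by blast
  note decomposition =
    drift_decomposition[OF tW' C1_differentiable_imp_continuous_on[OF W(3)] L, where S = "{0..T}"]
  \<comment> \<open>For N = 0 the scaling relation would read 0 = 1.\<close>
  have N_pos: "N > 0" if "real N * \<epsilon> powr \<theta> = 1" for N and \<epsilon> \<theta> :: real
    using that by (cases N) auto
  have bound: "u \<le> 10 * L * (sqrt \<epsilon> + \<epsilon> powr 1)" if "0 < \<epsilon>" "u \<le> 10 * L * \<epsilon>" for \<epsilon> u :: real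
  proof -
    have "10 * L * \<epsilon> \<le> 10 * L * (sqrt \<epsilon> + \<epsilon> powr 1)"
      using L(1) that(1) by (intro mult_left_mono) auto
    with that(2) show ?thesis
      by linarith
  qed
  show ?case
  \<comment> \<open>The same witness serves for \<open>C1\<close> and \<open>C2\<close>;
    \<open>L\<close> was obtained from W alone, before the initial density and the particle system
    are fixed.\<close>
  proof (intro exI[of _ "10 * L"] allI impI, elim conjE, goal_cases)
    case prems: (1 f0 M' B' q' p' \<theta> \<epsilon> N M B q p)
    have "prob_space M" "\<forall>t\<in>{0..T}. \<forall>i<N. q i t \<in> borel_measurable M"
      using prems by (auto simp: particle_system_def langevin_def)
    from decomposition[OF this(1) \<open>0 < \<epsilon>\<close> \<open>\<epsilon> \<le> 1\<close> N_pos[OF \<open>real N * \<epsilon> powr \<theta> = 1\<close>] this(2)]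
    show ?case
      by (elim ex_forward) (blast intro: bound[OF \<open>0 < \<epsilon>\<close>])
  qed
qed simp

end
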